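(* Let $X$ and $Y$ be Banach spaces over $\mathbb K\in\{\mathbb R,\mathbb C\}$. If $\mathrm{NA}_{\mathrm{nu}}(X,Y)=\mathcal N(X,Y)$, then $\ker(J)$ is a proximinal subspace of $X^*\widehat\otimes_\pi Y$, where $J\colon X^*\widehat\otimes_\pi Y\to\mathcal N(X,Y)$ is the canonical map.
   Context: $X^*\widehat\otimes_\pi Y$ is the projective tensor product, i.e. the completion of $X^*\otimes Y$ under $\|z\|_\pi=\inf\{\sum_{i=1}^n\|x_i^*\|\|y_i\|:z=\sum_{i=1}^nx_i^*\otimes y_i\}$. An operator $T\in\mathcal L(X,Y)$ is nuclear if $Tx=\sum_{i=1}^\infty x_i^*(x)y_i$ for all $x\in X$, with $x_i^*\in X^*$, $y_i\in Y$, $\sum_i\|x_i^*\|\|y_i\|<\infty$; $\|T\|_{\mathrm{nu}}$ is the infimum of $\sum_i\|x_i^*\|\|y_i\|$ over all such representations. $\mathcal N(X,Y)$ is the space of nuclear operators with norm $\|\cdot\|_{\mathrm{nu}}$, and $\mathrm{NA}_{\mathrm{nu}}(X,Y)$ is the set of nuclear operators for which the infimum is a minimum. The canonical map $J\colon X^*\widehat\otimes_\pi Y\to\mathcal N(X,Y)$ is $J(\sum_{i=1}^\infty x_i^*\otimes y_i)(x)=\sum_{i=1}^\infty x_i^*(x)y_i$; it is a norm-one quotient map inducing an isometric isomorphism $\mathcal N(X,Y)\equiv(X^*\widehat\otimes_\pi Y)/\ker(J)$. A subspace $W$ of a Banach space $Z$ is proximinal in $Z$ if for every $z\in Z$ the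 distance $\mathrm{dist}(z,W)=\inf\{\|z-w\|:w\in W\}$ is attained at some $w\in W$. *)

theory Defs
  imports "HOL-Analysis.Analysis" "HOL-Library.Function_Algebras"
begin

section \<open>Scalars and Banach spaces over them\<close>

text \<open>The scalar fields: a type belongs to this class iff it is isometrically isomorphic, as a
  normed field over the reals, to the real or to the complex numbers.\<close>

class rc_field = real_normed_field +
  assumes real_or_complex:
    "\<exists>\<phi> :: 'a \<Rightarrow> complex. (\<forall>a b. \<phi> (a + b) = \<phi> a + \<phi> b) \<and> (\<forall>r a. \<phi> (r *\<^sub>R a) = r *\<^sub>R \<phi> a) \<and>
       (\<forall>a b. \<phi> (a * b) = \<phi> a * \<phi> b) \<and> \<phi> 1 = 1 \<and>
       (\<forall>a. norm (\<phi> a) = norm a) \<and> (range \<phi> = \<real> \<or> range \<phi> = UNIV)"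

instance real :: rc_field
proof
  show "\<exists>\<phi> :: real \<Rightarrow> complex. (\<forall>a b. \<phi> (a + b) = \<phi> a + \<phi> b) \<and> (\<forall>r a. \<phi> (r *\<^sub>R a) = r *\<^sub>R \<phi> a) \<and>
       (\<forall>a b. \<phi> (a * b) = \<phi> a * \<phi> b) \<and> \<phi> 1 = 1 \<and>
       (\<forall>a. norm (\<phi> a) = norm a) \<and> (range \<phi> = \<real> \<or> range \<phi> = UNIV)"
    by (rule exI[of _ complex_of_real])
      (auto simp: Reals_def scaleR_conv_of_real)
qed

instance complex :: rc_field
proof
  show "\<exists>\<phi> :: complex \<Rightarrow> complex. (\<forall>a b. \<phi> (a + b) = \<phi> a + \<phi> b) \<and> (\<forall>r a. \<phi> (r *\<^sub>R a) = r *\<^sub>R \<phi> a) \<and>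
       (\<forall>a b. \<phi> (a * b) = \<phi> a * \<phi> b) \<and> \<phi> 1 = 1 \<and>
       (\<forall>a. norm (\<phi> a) = norm a) \<and> (range \<phi> = \<real> \<or> range \<phi> = UNIV)"
    by (rule exI[of _ id]) auto
qed

text \<open>A Banach space over \<open>'k\<close> is a real Banach space (a type of class \<^class>\<open>banach\<close>) whose real
  scalar multiplication is extended to \<open>'k\<close> by \<open>scale\<close>, with homogeneous norm.  For
  \<open>'k = real\<close> this forces \<open>scale\<close> to be \<open>scaleR\<close>.\<close>

locale banach_over = vector_space scale
  for scale :: "'k::rc_field \<Rightarrow> 'a::banach \<Rightarrow> 'a" +
  assumes scale_of_real: "scale (of_real r) x = r *\<^sub>R x"
    and norm_scale: "norm (scale c x) = norm c * norm x"

text \<open>The type \<open>'a \<Rightarrow>\<^sub>L 'b\<close> consists of the bounded real-linear maps with the operator norm;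
  \<open>operators\<close> are those that are linear over \<open>'k\<close>.\<close>

definition operators ::
  "('k::rc_field \<Rightarrow> 'a::real_normed_vector \<Rightarrow> 'a) \<Rightarrow>
   ('k \<Rightarrow> 'b::real_normed_vector \<Rightarrow> 'b) \<Rightarrow> ('a \<Rightarrow>\<^sub>L 'b) set" where
  "operators sX sY = {T. Vector_Spaces.linear sX sY (blinfun_apply T)}"

definition dual ::
  "('k::rc_field \<Rightarrow> 'a::real_normed_vector \<Rightarrow> 'a) \<Rightarrow> ('a \<Rightarrow>\<^sub>L 'k) set" where
  "dual sX = operators sX (*)"

definition dual_scale ::
  "'k::rc_field \<Rightarrow> ('a::real_normed_vector \<Rightarrow>\<^sub>L 'k) \<Rightarrow> ('a \<Rightarrow>\<^sub>L 'k)" where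
  "dual_scale c f = blinfun_mult_right c o\<^sub>L f"

section \<open>The projective tensor product\<close>

text \<open>Bilinear forms on the product of the dual of X with Y.  They are total functions on
  \<open>'x \<Rightarrow>\<^sub>L 'k\<close>, and their values outside the dual are irrelevant.\<close>

definition bilinear_forms ::
  "('k::rc_field \<Rightarrow> 'x::real_normed_vector \<Rightarrow> 'x) \<Rightarrow> ('k \<Rightarrow> 'y::real_normed_vector \<Rightarrow> 'y) \<Rightarrow>
   (('x \<Rightarrow>\<^sub>L 'k) \<Rightarrow> 'y \<Rightarrow> 'k) set" where
  "bilinear_forms sX sY = {B.
     (\<forall>f \<in> dual sX. Vector_Spaces.linear sY (*) (B f)) \<and>
     (\<forall>f \<in> dual sX. \<forall>g \<in> dual sX. \<forall>y. B (f + g) y = B f y + B g y) \<and>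
     (\<forall>f \<in> dual sX. \<forall>c y. B (dual_scale c f) y = c * B f y)}"

text \<open>The algebraic tensor product is realised, as usual, inside the space of all linear functionals
  on the bilinear forms: \<open>f \<otimes> y\<close> is evaluation at \<open>(f, y)\<close>, and the tensors are the span of
  these evaluations.\<close>

type_synonym ('k, 'x, 'y) tensor = "(('x \<Rightarrow>\<^sub>L 'k) \<Rightarrow> 'y \<Rightarrow> 'k) \<Rightarrow> 'k"

definition elem_tensor ::
  "('k::rc_field \<Rightarrow> 'x::real_normed_vector \<Rightarrow> 'x) \<Rightarrow> ('k \<Rightarrow> 'y::real_normed_vector \<Rightarrow> 'y) \<Rightarrow>
   ('x \<Rightarrow>\<^sub>L 'k) \<Rightarrow> 'y \<Rightarrow> ('k, 'x, 'y) tensor" where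
  "elem_tensor sX sY f y = (\<lambda>B. if B \<in> bilinear_forms sX sY then B f y else 0)"

definition tensor_scale :: "'k::rc_field \<Rightarrow> ('b \<Rightarrow> 'k) \<Rightarrow> ('b \<Rightarrow> 'k)" where
  "tensor_scale c u = (\<lambda>B. c * u B)"

definition alg_tensor ::
  "('k::rc_field \<Rightarrow> 'x::real_normed_vector \<Rightarrow> 'x) \<Rightarrow> ('k \<Rightarrow> 'y::real_normed_vector \<Rightarrow> 'y) \<Rightarrow>
   ('k, 'x, 'y) tensor set" where
  "alg_tensor sX sY = module.span tensor_scale {elem_tensor sX sY f y | f y. f \<in> dual sX}"

definition pi_norm ::
  "('k::rc_field \<Rightarrow> 'x::real_normed_vector \<Rightarrow> 'x) \<Rightarrow> ('k \<Rightarrow> 'y::real_normed_vector \<Rightarrow> 'y) \<Rightarrow>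
   ('k, 'x, 'y) tensor \<Rightarrow> real" where
  "pi_norm sX sY u = Inf {(\<Sum>i<n. norm (f i) * norm (y i)) | (n::nat) f y.
     (\<forall>i<n. f i \<in> dual sX) \<and> u = (\<Sum>i<n. elem_tensor sX sY (f i) (y i))}"

text \<open>\<open>Z\<close> (the whole type \<open>'z\<close>) together with the embedding \<open>\<iota>\<close> is a completion of the space
  \<open>V\<close> normed by \<open>N\<close>.\<close>

definition is_completion ::
  "('k::rc_field \<Rightarrow> 'v::ab_group_add \<Rightarrow> 'v) \<Rightarrow> 'v set \<Rightarrow> ('v \<Rightarrow> real) \<Rightarrow>
   ('k \<Rightarrow> 'z::banach \<Rightarrow> 'z) \<Rightarrow> ('v \<Rightarrow> 'z) \<Rightarrow> bool" where
  "is_completion sV V N sZ \<iota> \<longleftrightarrow>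
     banach_over sZ \<and>
     (\<forall>u \<in> V. \<forall>v \<in> V. \<iota> (u + v) = \<iota> u + \<iota> v) \<and>
     (\<forall>c. \<forall>u \<in> V. \<iota> (sV c u) = sZ c (\<iota> u)) \<and>
     (\<forall>u \<in> V. norm (\<iota> u) = N u) \<and>
     closure (\<iota> ` V) = UNIV"

text \<open>Completions are unique only up to isometric isomorphism, and a type cannot depend on
  \<open>sX\<close> and \<open>sY\<close>, so the projective tensor product is any completion \<open>(sZ, \<iota>)\<close> of the algebraic
  tensor product under the projective norm.\<close>

definition is_projective_tensor_product ::
  "('k::rc_field \<Rightarrow> 'x::real_normed_vector \<Rightarrow> 'x) \<Rightarrow> ('k \<Rightarrow> 'y::real_normed_vector \<Rightarrow> 'y) \<Rightarrow>
   ('k \<Rightarrow> 'z::banach \<Rightarrow> 'z) \<Rightarrow> (('k, 'x, 'y) tensor \<Rightarrow> 'z) \<Rightarrow> bool" where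
  "is_projective_tensor_product sX sY sZ \<iota> \<longleftrightarrow>
     is_completion tensor_scale (alg_tensor sX sY) (pi_norm sX sY) sZ \<iota>"

section \<open>Nuclear operators\<close>

definition nuclear_rep ::
  "('k::rc_field \<Rightarrow> 'x::real_normed_vector \<Rightarrow> 'x) \<Rightarrow> ('k \<Rightarrow> 'y::real_normed_vector \<Rightarrow> 'y) \<Rightarrow>
   ('x \<Rightarrow>\<^sub>L 'y) \<Rightarrow> (nat \<Rightarrow> 'x \<Rightarrow>\<^sub>L 'k) \<Rightarrow> (nat \<Rightarrow> 'y) \<Rightarrow> bool" where
  "nuclear_rep sX sY T f y \<longleftrightarrow>
     (\<forall>i. f i \<in> dual sX) \<and>
     summable (\<lambda>i. norm (f i) * norm (y i)) \<and>
     (\<forall>x. (\<lambda>i. sY (f i x) (y i)) sums T x)"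

definition nuclear_operators ::
  "('k::rc_field \<Rightarrow> 'x::real_normed_vector \<Rightarrow> 'x) \<Rightarrow> ('k \<Rightarrow> 'y::real_normed_vector \<Rightarrow> 'y) \<Rightarrow>
   ('x \<Rightarrow>\<^sub>L 'y) set" where
  "nuclear_operators sX sY = {T \<in> operators sX sY. \<exists>f y. nuclear_rep sX sY T f y}"

definition nuclear_norm ::
  "('k::rc_field \<Rightarrow> 'x::real_normed_vector \<Rightarrow> 'x) \<Rightarrow> ('k \<Rightarrow> 'y::real_normed_vector \<Rightarrow> 'y) \<Rightarrow>
   ('x \<Rightarrow>\<^sub>L 'y) \<Rightarrow> real" where
  "nuclear_norm sX sY T =
     Inf {(\<Sum>i. norm (f i) * norm (y i)) | f y. nuclear_rep sX sY T f y}"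

definition NA_nu ::
  "('k::rc_field \<Rightarrow> 'x::real_normed_vector \<Rightarrow> 'x) \<Rightarrow> ('k \<Rightarrow> 'y::real_normed_vector \<Rightarrow> 'y) \<Rightarrow>
   ('x \<Rightarrow>\<^sub>L 'y) set" where
  "NA_nu sX sY = {T \<in> nuclear_operators sX sY.
     \<exists>f y. nuclear_rep sX sY T f y \<and> (\<Sum>i. norm (f i) * norm (y i)) = nuclear_norm sX sY T}"

text \<open>\<open>J z\<close> is the operator \<open>x \<mapsto> (\<Sum>i. f i x \<cdot> y i)\<close> for any representation
  \<open>z = (\<Sum>i. f i \<otimes> y i)\<close> with \<open>(\<Sum>i. \<parallel>f i\<parallel> \<parallel>y i\<parallel>) < \<infinity>\<close>.  Every \<open>z\<close> has one, and the
  operator does not depend on its choice, so the description is proper.\<close>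

definition canonical_J ::
  "('k::rc_field \<Rightarrow> 'x::real_normed_vector \<Rightarrow> 'x) \<Rightarrow> ('k \<Rightarrow> 'y::real_normed_vector \<Rightarrow> 'y) \<Rightarrow>
   (('k, 'x, 'y) tensor \<Rightarrow> 'z::banach) \<Rightarrow> 'z \<Rightarrow> ('x \<Rightarrow>\<^sub>L 'y)" where
  "canonical_J sX sY \<iota> z = (THE T. T \<in> nuclear_operators sX sY \<and>
     (\<exists>f y. nuclear_rep sX sY T f y \<and> (\<lambda>i. \<iota> (elem_tensor sX sY (f i) (y i))) sums z))"

section \<open>Proximinality\<close>

definition proximinal_subspace ::
  "('k::rc_field \<Rightarrow> 'z::real_normed_vector \<Rightarrow> 'z) \<Rightarrow> 'z set \<Rightarrow> bool" where
  "proximinal_subspace sZ W \<longleftrightarrow>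
     module.subspace sZ W \<and> (\<forall>z. \<exists>w \<in> W. norm (z - w) = (INF v \<in> W. norm (z - v)))"

end

theory Submission
  imports Defs
begin

text \<open>Every tensor \<open>z\<close> has absolutely convergent representations of total weight arbitrarily close to
  its norm, and each of them represents \<open>J z\<close>, so \<open>\<parallel>J z\<parallel>\<close> in the nuclear norm is at most \<open>\<parallel>z\<parallel>\<close>.
  Conversely, a norm-attaining representation of \<open>J z\<close>, read as a series of tensors, converges to some
  \<open>z'\<close> with \<open>J z' = J z\<close> and \<open>\<parallel>z'\<parallel> \<le> \<parallel>J z\<parallel> = \<parallel>J (z - v)\<parallel> \<le> \<parallel>z - v\<parallel>\<close> for every \<open>v\<close> in the
  kernel.  Hence \<open>z - z'\<close> is a point of the kernel nearest to \<open>z\<close>.\<close>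

section \<open>Absolutely convergent double series\<close>

text \<open>The majorant \<open>N\<close> is nonnegative with summable row sums, so
  \<open>N\<close>, and with it \<open>a\<close>, is summable over all pairs in any order and can be
  reindexed along the bijection \<open>prod_decode\<close>. This later flattens a series of finite
  representations without changing the total weight.\<close>

lemma sums_prod_decode:
  fixes a :: "nat \<times> nat \<Rightarrow> 'a::banach"
  assumes le: "\<And>p. norm (a p) \<le> N p"
    and N: "\<And>k. (\<lambda>j. N (k, j)) sums s k" and s: "s sums S"
    and a: "\<And>k. (\<lambda>j. a (k, j)) sums g k" and g: "g sums z"
  shows "(\<lambda>i. N (prod_decode i)) sums S" and "(\<lambda>i. a (prod_decode i)) sums z"
proof -
  have N0: "0 \<le> N p" for p
    using le[of p] norm_ge_zero order_trans by blast
  have s0: "0 \<le> s k" for k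
    using sums_le[OF N0 sums_zero N] .
  have Nk: "((\<lambda>j. N (k, j)) has_sum s k) UNIV" for k
    by (rule sums_nonneg_imp_has_sum[OF N N0])
  have sS: "(s has_sum S) UNIV"
    by (rule sums_nonneg_imp_has_sum[OF s s0])
  have inf_eq: "infsum (\<lambda>j. N (k, j)) UNIV = s k" for k
    using Nk infsumI by blast
  have "(\<lambda>p. norm (N p)) summable_on UNIV \<times> UNIV"
    by (rule Infinite_Sum.abs_summable_on_Sigma_iff[THEN iffD2])
      (use Nk sS N0 s0 in \<open>auto simp: inf_eq summable_on_def\<close>)
  then have Nsum: "N summable_on UNIV \<times> UNIV"
    by (rule abs_summable_summable)
  have "(N has_sum S) (UNIV \<times> UNIV)"
    by (rule has_sum_SigmaI[where g = s, OF _ sS Nsum]) (rule Nk)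
  then have "((\<lambda>i. N (prod_decode i)) has_sum S) UNIV"
    using has_sum_reindex_bij_betw[OF bij_prod_decode, of N S] by simp
  then show "(\<lambda>i. N (prod_decode i)) sums S"
    by (rule has_sum_imp_sums)
  have "(\<lambda>p. norm (a p)) summable_on UNIV \<times> UNIV"
    by (rule Infinite_Sum.abs_summable_on_comparison_test'[OF Nsum]) (rule le)
  then obtain A where A: "(a has_sum A) (UNIV \<times> UNIV)"
    using abs_summable_summable summable_on_def by blast
  \<comment> \<open>Summing \<open>a\<close> row by row identifies the unordered sum
    \<open>A\<close> with the iterated sum \<open>z\<close>.\<close>
  have "((\<lambda>j. a (k, j)) has_sum g k) UNIV" for k
  proof (rule norm_summable_imp_has_sum[OF _ a])
    show "summable (\<lambda>j. norm (a (k, j)))"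
      by (rule summable_comparison_test'[where N = 0, OF sums_summable[OF N[of k]]]) (simp add: le)
  qed
  then have "(g has_sum A) UNIV"
    by (intro has_sum_SigmaD[OF A])
  then have "g sums A"
    by (rule has_sum_imp_sums)
  then have "A = z"
    using g sums_unique2 by blast
  then have "((\<lambda>i. a (prod_decode i)) has_sum z) UNIV"
    using has_sum_reindex_bij_betw[OF bij_prod_decode, of a A] A by simp
  then show "(\<lambda>i. a (prod_decode i)) sums z"
    by (rule has_sum_imp_sums)
qed

section \<open>Scalar multiplication and algebraic functionals\<close>

lemma vector_space_field: "vector_space ((*) :: 'k::field \<Rightarrow> 'k \<Rightarrow> 'k)"
  by unfold_locales (simp_all add: algebra_simps)

lemma module_tensor_scale: "module (tensor_scale :: 'k::rc_field \<Rightarrow> ('b \<Rightarrow> 'k) \<Rightarrow> ('b \<Rightarrow> 'k))"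
  by unfold_locales (simp_all add: tensor_scale_def fun_eq_iff algebra_simps)

lemma sum_apply: "(\<Sum>i\<in>A. f i) x = (\<Sum>i\<in>A. f i x)"
  for f :: "'i \<Rightarrow> 'a \<Rightarrow> 'b::comm_monoid_add"
  by (induction A rule: infinite_finite_induct) auto

context banach_over
begin

lemma scaleR_eq: "scale (r *\<^sub>R c) x = r *\<^sub>R scale c x"
  by (metis scale_of_real scale_scale scaleR_conv_of_real)

lemma bounded_linear_scale_left: "bounded_linear (\<lambda>c. scale c x)"
  by (rule bounded_linear_intro[where K = "norm x"])
    (auto simp: scale_left_distrib scaleR_eq norm_scale)

lemma bounded_linear_scale_right: "bounded_linear (scale c)"
proof (rule bounded_linear_intro[where K = "norm c"])
  show "scale c (r *\<^sub>R x) = r *\<^sub>R scale c x" for r x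
    by (metis scale_of_real scale_left_commute)
qed (auto simp: scale_right_distrib norm_scale mult.commute)

text \<open>A nonzero \<open>v - w\<close> is linearly independent, so the value 1 on it extends,
  through a basis, to a linear functional on the whole space.\<close>

lemma algebraic_functionals_separate:
  assumes "\<And>\<phi>. Vector_Spaces.linear scale (*) \<phi> \<Longrightarrow> \<phi> v = \<phi> w"
  shows "v = w"
proof (rule ccontr)
  assume "v \<noteq> w"
  interpret P: vector_space_pair scale "(*) :: 'k \<Rightarrow> 'k \<Rightarrow> 'k"
    by (intro vector_space_pair.intro vector_space_field) unfold_locales
  have "independent {v - w}"
    using \<open>v \<noteq> w\<close> by simp
  from P.linear_independent_extend[OF this, of "\<lambda>_. 1"] obtain \<phi>
    where \<phi>: "Vector_Spaces.linear scale (*) \<phi>" "\<phi> (v - w) = 1"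
    by auto
  then have "\<phi> v - \<phi> w = 1"
    using P.linear_diff by metis
  then show False
    using assms[OF \<phi>(1)] by simp
qed

end

section \<open>Algebraic tensors inside the completion\<close>

locale projective_tensor_product =
  X: banach_over sX + Y: banach_over sY
  for sX :: "'k::rc_field \<Rightarrow> 'x::banach \<Rightarrow> 'x"
    and sY :: "'k \<Rightarrow> 'y::banach \<Rightarrow> 'y"
    and sZ :: "'k \<Rightarrow> 'z::banach \<Rightarrow> 'z"
    and \<iota> :: "('k, 'x, 'y) tensor \<Rightarrow> 'z" +
  assumes projective: "is_projective_tensor_product sX sY sZ \<iota>"
begin

sublocale Z: banach_over sZ
  using projective by (simp add: is_projective_tensor_product_def is_completion_def)

sublocale T: module "tensor_scale :: 'k \<Rightarrow> ('k, 'x, 'y) tensor \<Rightarrow> _"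
  by (rule module_tensor_scale)

abbreviation "V \<equiv> alg_tensor sX sY"
abbreviation "elem \<equiv> elem_tensor sX sY"

lemma subspace_V: "T.subspace V"
  by (simp add: alg_tensor_def)

lemma elem_V: "f \<in> dual sX \<Longrightarrow> elem f y \<in> V"
  unfolding alg_tensor_def by (intro T.span_base) blast

lemma iota_add: "u \<in> V \<Longrightarrow> v \<in> V \<Longrightarrow> \<iota> (u + v) = \<iota> u + \<iota> v"
  and iota_scale: "u \<in> V \<Longrightarrow> \<iota> (tensor_scale c u) = sZ c (\<iota> u)"
  and norm_iota: "u \<in> V \<Longrightarrow> norm (\<iota> u) = pi_norm sX sY u"
  and dense_iota: "closure (\<iota> ` V) = UNIV"
  using projective by (simp_all add: is_projective_tensor_product_def is_completion_def)

lemma iota_zero: "\<iota> 0 = 0"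
  using iota_add[of 0 0] T.subspace_0[OF subspace_V] by simp

lemma iota_diff:
  assumes "u \<in> V" "v \<in> V"
  shows "\<iota> (u - v) = \<iota> u - \<iota> v"
  using iota_add[OF T.subspace_diff[OF subspace_V assms] assms(2)] by simp

lemma iota_sum: "(\<And>i. i \<in> A \<Longrightarrow> u i \<in> V) \<Longrightarrow> \<iota> (\<Sum>i\<in>A. u i) = (\<Sum>i\<in>A. \<iota> (u i))"
  by (induction A rule: infinite_finite_induct)
    (auto simp: iota_zero iota_add T.subspace_sum[OF subspace_V])

lemma bilinear_formD:
  assumes "B \<in> bilinear_forms sX sY" "f \<in> dual sX"
  shows "B f (sY c y) = c * B f y"
proof -
  have "Vector_Spaces.linear sY (*) (B f)"
    using assms by (simp add: bilinear_forms_def)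
  then show ?thesis
    by (simp add: Vector_Spaces.linear_iff)
qed

lemma elem_scale: "f \<in> dual sX \<Longrightarrow> tensor_scale c (elem f y) = elem f (sY c y)"
  by (auto simp: tensor_scale_def elem_tensor_def bilinear_formD)

lemma zero_dual: "0 \<in> dual sX"
  by (simp add: dual_def operators_def Vector_Spaces.linear_iff X.vector_space_axioms
      vector_space_field)

text \<open>Lets finite representations be padded to infinite series.\<close>

lemma elem_zero: "elem 0 y = 0"
proof -
  have "B 0 y = 0" if "B \<in> bilinear_forms sX sY" for B
  proof -
    have "B (0 + 0) y = B 0 y + B 0 y"
      using that zero_dual unfolding bilinear_forms_def by blast
    then show ?thesis by simp
  qed
  then show ?thesis
    by (auto simp: elem_tensor_def)
qed

text \<open>The coefficients of a linear combination are absorbed into the second factor by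
  \<open>elem_scale\<close>. Hence the infimum in \<open>pi_norm\<close> runs over a nonempty
  set.\<close>

lemma alg_tensor_finite_rep:
  assumes "u \<in> V"
  shows "\<exists>n f y. (\<forall>i<(n::nat). f i \<in> dual sX) \<and> u = (\<Sum>i<n. elem (f i) (y i))"
  using assms unfolding alg_tensor_def
proof (induction rule: T.span_induct_alt)
  case base
  show ?case by (intro exI[of _ 0]) auto
next
  case (step c e u)
  then obtain g w where e: "e = elem g w" and g: "g \<in> dual sX" by blast
  from step obtain n f y where u: "\<forall>i<(n::nat). f i \<in> dual sX" "u = (\<Sum>i<n. elem (f i) (y i))"
    by blast
  have "tensor_scale c e + u = (\<Sum>i<Suc n. elem ((f(n := g)) i) ((y(n := sY c w)) i))"
    using u g by (simp add: e elem_scale add.commute)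
  moreover have "\<forall>i<Suc n. (f(n := g)) i \<in> dual sX"
    using u g by simp
  ultimately show ?case by blast
qed

abbreviation rep_sums :: "('k, 'x, 'y) tensor \<Rightarrow> real set" where
  "rep_sums u \<equiv> {(\<Sum>i<n. norm (f i) * norm (y i)) | (n::nat) f y.
     (\<forall>i<n. f i \<in> dual sX) \<and> u = (\<Sum>i<n. elem (f i) (y i))}"

lemma rep_sums_nonempty: "u \<in> V \<Longrightarrow> rep_sums u \<noteq> {}"
  using alg_tensor_finite_rep[of u] by blast

lemma rep_sums_bdd_below: "bdd_below (rep_sums u)"
  by (rule bdd_belowI[of _ 0]) (auto intro!: sum_nonneg)

text \<open>The one-term representation competes in the infimum.\<close>

lemma norm_iota_elem:
  assumes f: "f \<in> dual sX"
  shows "norm (\<iota> (elem f y)) \<le> norm f * norm y"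
proof -
  have "norm f * norm y \<in> rep_sums (elem f y)"
    using f by (auto intro!: exI[of _ "1::nat"] exI[of _ "\<lambda>_. f"] exI[of _ "\<lambda>_. y"])
  then show ?thesis
    using cInf_lower[OF _ rep_sums_bdd_below]
    by (simp add: norm_iota[OF elem_V[OF f]] pi_norm_def)
qed

lemma pi_norm_finite_rep:
  assumes "u \<in> V" "pi_norm sX sY u < r"
  obtains n f y where "\<forall>i<(n::nat). f i \<in> dual sX" "u = (\<Sum>i<n. elem (f i) (y i))"
    "(\<Sum>i<n. norm (f i) * norm (y i)) < r"
proof -
  from cInf_lessD[OF rep_sums_nonempty[OF assms(1)] assms(2)[unfolded pi_norm_def]]
  show ?thesis using that by blast
qed

section \<open>Evaluating algebraic tensors at points of X\<close>

text \<open>\<open>evaluates x u v\<close> says that the operator induced by the algebraic tensor \<open>u\<close> sends \<open>x\<close> to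
  \<open>v\<close>.  Since the bilinear forms are not required to be bounded, algebraic functionals suffice to
  determine \<open>v\<close>, and Hahn-Banach is not needed.\<close>

definition evaluates :: "'x \<Rightarrow> ('k, 'x, 'y) tensor \<Rightarrow> 'y \<Rightarrow> bool" where
  "evaluates x u v \<longleftrightarrow>
     (\<forall>\<phi>. Vector_Spaces.linear sY (*) \<phi> \<longrightarrow> u (\<lambda>f y. \<phi> (sY (f x) y)) = \<phi> v)"

text \<open>Makes these forms legitimate test arguments: outside \<open>bilinear_forms\<close> an
  elementary tensor takes the default value 0.\<close>

lemma evaluation_bilinear:
  assumes "Vector_Spaces.linear sY (*) \<phi>"
  shows "(\<lambda>(f :: 'x \<Rightarrow>\<^sub>L 'k) y. \<phi> (sY (f x) y)) \<in> bilinear_forms sX sY"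
  using assms
  by (simp add: bilinear_forms_def Vector_Spaces.linear_iff blinfun.add_left Y.scale_left_distrib
      Y.scale_right_distrib dual_scale_def mult.left_commute distrib_left distrib_right)

lemma evaluates_elem: "evaluates x (elem f y) (sY (f x) y)"
  by (simp add: evaluates_def elem_tensor_def evaluation_bilinear)

lemma evaluates_diff: "evaluates x u v \<Longrightarrow> evaluates x u' v' \<Longrightarrow> evaluates x (u - u') (v - v')"
  using module_hom.diff[of sY "(*)"]
  by (auto simp: evaluates_def linear_iff_module_hom)

lemma evaluates_scale: "evaluates x u v \<Longrightarrow> evaluates x (tensor_scale c u) (sY c v)"
  by (auto simp: evaluates_def tensor_scale_def Vector_Spaces.linear_iff)

lemma evaluates_sum:
  "(\<And>i. i \<in> A \<Longrightarrow> evaluates x (u i) (v i)) \<Longrightarrow> evaluates x (\<Sum>i\<in>A. u i) (\<Sum>i\<in>A. v i)"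
  by (simp add: evaluates_def linear_iff_module_hom sum_apply module_hom.sum[of sY "(*)"])

lemma evaluates_unique: "evaluates x u v \<Longrightarrow> evaluates x u w \<Longrightarrow> v = w"
  by (rule Y.algebraic_functionals_separate) (metis evaluates_def)

text \<open>By \<open>evaluates_unique\<close>, \<open>v\<close> can be computed from any finite
  representation of \<open>u\<close>, in particular from a nearly optimal one, where the triangle
  inequality applies. This continuity estimate is what makes J well defined on the
  completion.\<close>

lemma evaluates_bound:
  assumes "u \<in> V" "evaluates x u v"
  shows "norm v \<le> norm x * norm (\<iota> u)"
proof (rule field_le_epsilon)
  fix e :: real assume "e > 0"
  \<comment> \<open>The summand 1 keeps the denominator positive when \<open>x = 0\<close> and still
    gives \<open>norm x * d \<le> e\<close>.\<close>
  define d where "d = e / (norm x + 1)"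
  have "d > 0"
    using \<open>e > 0\<close> by (simp add: d_def add_nonneg_pos)
  then obtain n f y where f: "\<forall>i<(n::nat). f i \<in> dual sX" "u = (\<Sum>i<n. elem (f i) (y i))"
    and lt: "(\<Sum>i<n. norm (f i) * norm (y i)) < pi_norm sX sY u + d"
    using pi_norm_finite_rep[OF assms(1), of "pi_norm sX sY u + d"] by auto
  have "evaluates x u (\<Sum>i<n. sY (f i x) (y i))"
    unfolding f(2) by (intro evaluates_sum evaluates_elem)
  then have "v = (\<Sum>i<n. sY (f i x) (y i))"
    using assms(2) evaluates_unique by blast
  also have "norm \<dots> \<le> (\<Sum>i<n. norm x * (norm (f i) * norm (y i)))"
  proof (rule sum_norm_le)
    show "norm (sY (f i x) (y i)) \<le> norm x * (norm (f i) * norm (y i))" for i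
      using mult_right_mono[OF norm_blinfun[of "f i" x], of "norm (y i)"]
      by (simp add: Y.norm_scale mult_ac)
  qed
  also have "\<dots> = norm x * (\<Sum>i<n. norm (f i) * norm (y i))"
    by (simp add: sum_distrib_left)
  also have "\<dots> \<le> norm x * (pi_norm sX sY u + d)"
    using lt by (intro mult_left_mono) auto
  also have "\<dots> \<le> norm x * norm (\<iota> u) + e"
  proof -
    have "norm x * d \<le> (norm x + 1) * d"
      using \<open>d > 0\<close> by (intro mult_right_mono) auto
    also have "\<dots> = e"
      unfolding d_def by (metis add_nonneg_pos less_irrefl nonzero_mult_div_cancel_left
          norm_ge_zero times_divide_eq_right zero_less_one)
    finally show ?thesis
      by (simp add: norm_iota[OF assms(1)] distrib_left)
  qed
  finally show "norm v \<le> norm x * norm (\<iota> u) + e" .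
qed

section \<open>Series representations in the completion\<close>

text \<open>Differs from \<open>nuclear_rep\<close> only in the last clause: the series converges in
  the completion instead of pointwise as an operator.\<close>

definition tensor_rep :: "'z \<Rightarrow> (nat \<Rightarrow> 'x \<Rightarrow>\<^sub>L 'k) \<Rightarrow> (nat \<Rightarrow> 'y) \<Rightarrow> bool" where
  "tensor_rep z f y \<longleftrightarrow> (\<forall>i. f i \<in> dual sX) \<and> summable (\<lambda>i. norm (f i) * norm (y i)) \<and>
     (\<lambda>i. \<iota> (elem (f i) (y i))) sums z"

lemma tensor_rep_exists:
  assumes "e > 0"
  shows "\<exists>f y. tensor_rep z f y \<and> (\<Sum>i. norm (f i) * norm (y i)) \<le> norm z + e"
proof -
  \<comment> \<open>\<open>z\<close> is a telescoping series of algebraic tensors; finite representations of its terms,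
    padded with zeros, form a double series.\<close>
  define d :: "nat \<Rightarrow> real" where "d k = e / 6 * (1/2)^k" for k
  have d0: "d k > 0" for k
    using assms by (simp add: d_def)
  have dS: "d (Suc k) = d k / 2" for k
    by (simp add: d_def)
  have d_sums: "d sums (e / 3)"
    unfolding d_def using sums_mult[OF geometric_sums[of "1/2::real"], of "e/6"] by simp
  have "\<exists>w\<in>V. dist (\<iota> w) z < d k" for k
    using dense_iota d0[of k] closure_approachable[of z "\<iota> ` V"] by auto
  then obtain w where w: "\<And>k. w k \<in> V" "\<And>k. norm (\<iota> (w k) - z) < d k"
    unfolding dist_norm by metis
  define v where "v k = (case k of 0 \<Rightarrow> w 0 | Suc j \<Rightarrow> w (Suc j) - w j)" for k
  \<comment> \<open>Weight budget: since \<open>d 0 = e / 6\<close>, the term \<open>w 0\<close>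
    costs less than \<open>norm z + e / 3\<close>; the differences cost \<open>2 * d j\<close> each,
    hence \<open>2 * e / 3\<close> altogether. The total is \<open>norm z + e\<close>.\<close>
  define b where "b k = (case k of 0 \<Rightarrow> norm z + e / 3 | Suc j \<Rightarrow> 2 * d j)" for k
  have v: "v k \<in> V" for k
    by (cases k) (auto simp: v_def w T.subspace_diff[OF subspace_V])
  have vb: "pi_norm sX sY (v k) < b k" for k
  proof (cases k)
    case 0
    have "norm (\<iota> (w 0)) < norm z + e / 3"
      using w(2)[of 0] norm_triangle_sub[of "\<iota> (w 0)" z] assms by (simp add: d_def)
    then show ?thesis
      using 0 v[of k] by (simp add: norm_iota[symmetric] v_def b_def)
  next
    case (Suc j)
    have "norm (\<iota> (w (Suc j)) - \<iota> (w j)) < d (Suc j) + d j"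
      using norm_triangle_ineq4[of "\<iota> (w (Suc j)) - z" "\<iota> (w j) - z"] w(2)[of j] w(2)[of "Suc j"]
      by simp
    also have "\<dots> \<le> 2 * d j"
      using dS[of j] d0[of j] by simp
    finally show ?thesis
      using Suc v[of k] by (simp add: norm_iota[symmetric] v_def b_def iota_diff w)
  qed
  have "\<forall>k. \<exists>n f y. (\<forall>i<(n::nat). f i \<in> dual sX) \<and> v k = (\<Sum>i<n. elem (f i) (y i)) \<and>
     (\<Sum>i<n. norm (f i) * norm (y i)) < b k"
  proof
    fix k
    show "\<exists>n f y. (\<forall>i<(n::nat). f i \<in> dual sX) \<and> v k = (\<Sum>i<n. elem (f i) (y i)) \<and>
        (\<Sum>i<n. norm (f i) * norm (y i)) < b k"
      by (rule pi_norm_finite_rep[OF v[of k] vb[of k]]) blast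
  qed
  then obtain n f y where f: "\<And>k i. i < (n k :: nat) \<Longrightarrow> f k i \<in> dual sX"
    and vk: "\<And>k. v k = (\<Sum>i<n k. elem (f k i) (y k i))"
    and fb: "\<And>k. (\<Sum>i<n k. norm (f k i) * norm (y k i)) < b k"
    unfolding choice_iff by blast
  \<comment> \<open>Past \<open>n k\<close> only the functional is set to 0; this already
    annihilates both the weight and the tensor, whatever \<open>U\<close> is there.\<close>
  define F where "F = (\<lambda>(k, i). if i < n k then f k i else 0)"
  define U where "U = (\<lambda>(k, i). y k i)"
  define s where "s k = (\<Sum>i<n k. norm (f k i) * norm (y k i))" for k
  have F: "F p \<in> dual sX" for p
    by (auto simp: F_def f zero_dual split: prod.split)
  have "(\<lambda>j. d j * 2) sums (e / 3 * 2)"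
    by (rule sums_mult2[OF d_sums])
  then have b_sums: "b sums (norm z + e)"
    using sums_Suc_iff[of b] by (simp add: b_def mult.commute algebra_simps)
  have s_le: "s k \<le> b k" and s_nn: "0 \<le> s k" for k
    using fb[of k] by (auto simp: s_def intro!: sum_nonneg)
  have s_summable: "summable s"
    by (rule summable_comparison_test'[where N = 0, OF sums_summable[OF b_sums]])
      (simp add: s_le s_nn)
  have row: "(\<lambda>i. norm (F (k, i)) * norm (U (k, i))) sums s k" for k
    using sums_finite[of "{..<n k}" "\<lambda>i. norm (F (k, i)) * norm (U (k, i))"]
    by (simp add: F_def U_def s_def)
  have row': "(\<lambda>i. \<iota> (elem (F (k, i)) (U (k, i)))) sums \<iota> (v k)" for k
  proof -
    have "\<iota> (v k) = (\<Sum>i<n k. \<iota> (elem (F (k, i)) (U (k, i))))"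
      unfolding vk by (subst iota_sum) (auto simp: f elem_V F_def U_def)
    then show ?thesis
      using sums_finite[of "{..<n k}" "\<lambda>i. \<iota> (elem (F (k, i)) (U (k, i)))"]
      by (simp add: F_def U_def elem_zero iota_zero)
  qed
  \<comment> \<open>Telescoping, with \<open>v 0 = w 0\<close>: it takes \<open>Suc m\<close> terms
    to reach \<open>w m\<close>, hence the index shift when passing to the limit below.\<close>
  have "(\<Sum>k<Suc m. \<iota> (v k)) = \<iota> (w m)" for m
    by (induction m) (simp_all add: v_def iota_diff w)
  moreover have "(\<lambda>m. \<iota> (w m)) \<longlonglongrightarrow> z"
    using sums_summable[OF d_sums, THEN summable_LIMSEQ_zero]
    by (subst LIM_zero_iff[symmetric], rule Lim_null_comparison[rotated])
      (auto intro!: always_eventually less_imp_le w(2))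
  ultimately have v_sums: "(\<lambda>k. \<iota> (v k)) sums z"
    unfolding sums_def by (subst filterlim_sequentially_Suc[symmetric]) simp
  note sums = sums_prod_decode[where a = "\<lambda>p. \<iota> (elem (F p) (U p))"
      and N = "\<lambda>p. norm (F p) * norm (U p)",
      OF norm_iota_elem[OF F] row summable_sums[OF s_summable] row' v_sums]
  have "tensor_rep z (\<lambda>i. F (prod_decode i)) (\<lambda>i. U (prod_decode i))"
    using F sums sums_summable by (auto simp: tensor_rep_def)
  moreover have "(\<Sum>i. norm (F (prod_decode i)) * norm (U (prod_decode i))) \<le> norm z + e"
    using sums(1) sums_le[OF s_le summable_sums[OF s_summable] b_sums]
    by (simp add: sums_unique[symmetric])
  ultimately show ?thesis by blast
qed

section \<open>Operators defined by nuclear series\<close>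

text \<open>The rank-one operators \<open>R i\<close> have norms bounded by the weights, so their
  series converges absolutely in the Banach space of bounded operators, and therefore also
  pointwise.\<close>

lemma nuclear_rep_exists:
  assumes dual: "\<And>i. f i \<in> dual sX" and summable: "summable (\<lambda>i. norm (f i) * norm (y i))"
  shows "\<exists>T. nuclear_rep sX sY T f y"
proof -
  define R where "R i = Blinfun (\<lambda>x. sY (f i x) (y i))" for i
  have R: "blinfun_apply (R i) x = sY (f i x) (y i)" for i x
    unfolding R_def
    using bounded_linear_compose[OF Y.bounded_linear_scale_left blinfun.bounded_linear_right]
    by (subst bounded_linear_Blinfun_apply) auto
  have "norm (R i) \<le> norm (f i) * norm (y i)" for i
    using mult_right_mono[OF norm_blinfun[of "f i"], of "norm (y i)"]
    by (intro norm_blinfun_bound) (auto simp: R Y.norm_scale mult_ac)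
  then have "summable R"
    by (intro summable_comparison_test'[where N = 0, OF summable]) auto
  then have "(\<lambda>i. blinfun_apply (R i) x) sums suminf R x" for x
    by (intro bounded_linear.sums[OF blinfun.bounded_linear_left] summable_sums)
  then show ?thesis
    using assms by (auto simp: nuclear_rep_def R)
qed

text \<open>\<open>T\<close> is a priori only real-linear; homogeneity over the scalar field passes
  from the terms to the limit by continuity of \<open>sY c\<close>.\<close>

lemma nuclear_rep_operator:
  assumes "nuclear_rep sX sY T f y"
  shows "T \<in> nuclear_operators sX sY"
proof -
  have "T (sX c x) = sY c (T x)" for c x
  proof -
    have "f i (sX c x) = c * f i x" for i
      using assms by (auto simp: nuclear_rep_def dual_def operators_def Vector_Spaces.linear_iff)
    then have "(\<lambda>i. sY c (sY (f i x) (y i))) sums T (sX c x)"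
      using assms by (metis (no_types, lifting) Y.scale_scale nuclear_rep_def sums_cong)
    moreover have "(\<lambda>i. sY c (sY (f i x) (y i))) sums sY c (T x)"
      using assms
      by (intro bounded_linear.sums[OF Y.bounded_linear_scale_right]) (simp add: nuclear_rep_def)
    ultimately show ?thesis
      using sums_unique2 by blast
  qed
  then have "T \<in> operators sX sY"
    by (simp add: operators_def Vector_Spaces.linear_iff X.vector_space_axioms
        Y.vector_space_axioms blinfun.add_right)
  then show ?thesis
    using assms by (auto simp: nuclear_operators_def)
qed

section \<open>The graph of the canonical map\<close>

text \<open>The graph of J as a relation, usable before J is known to be single-valued; one common
  pair \<open>f\<close>, \<open>y\<close> must represent both the tensor and the operator.\<close>

definition induces :: "'z \<Rightarrow> ('x \<Rightarrow>\<^sub>L 'y) \<Rightarrow> bool" where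
  "induces z T \<longleftrightarrow> (\<exists>f y. tensor_rep z f y \<and> nuclear_rep sX sY T f y)"

lemma tensor_rep_induces:
  assumes "tensor_rep z f y"
  shows "\<exists>T. nuclear_rep sX sY T f y \<and> induces z T"
  using assms nuclear_rep_exists[of f y] by (auto simp: tensor_rep_def induces_def)

lemma induces_total: "\<exists>T. induces z T"
  using tensor_rep_exists[of 1 z] tensor_rep_induces by fastforce

text \<open>The weights dominate the norms of the elementary tensors, so the same series converges
  absolutely in the completion. An attaining representation thus yields a preimage under J of norm
  at most the nuclear norm.\<close>

lemma nuclear_rep_induces:
  assumes "nuclear_rep sX sY T f y"
  shows "\<exists>z. induces z T \<and> norm z \<le> (\<Sum>i. norm (f i) * norm (y i))"
proof -
  have f: "f i \<in> dual sX" and sm: "summable (\<lambda>i. norm (f i) * norm (y i))" for i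
    using assms by (auto simp: nuclear_rep_def)
  have le: "norm (\<iota> (elem (f i) (y i))) \<le> norm (f i) * norm (y i)" for i
    by (rule norm_iota_elem[OF f])
  have n: "summable (\<lambda>i. norm (\<iota> (elem (f i) (y i))))"
    by (rule summable_comparison_test'[where N = 0, OF sm]) (simp add: le)
  let ?z = "\<Sum>i. \<iota> (elem (f i) (y i))"
  have "tensor_rep ?z f y"
    using f sm summable_norm_cancel[OF n] by (simp add: tensor_rep_def summable_sums)
  moreover have "norm ?z \<le> (\<Sum>i. norm (f i) * norm (y i))"
    using summable_norm[OF n] suminf_le[OF le n sm] by linarith
  ultimately show ?thesis
    using assms by (auto simp: induces_def)
qed

text \<open>Partial sums of the common series. Only algebraic tensors and their values are kept,
  which is all that \<open>evaluates_bound\<close> can compare.\<close>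

lemma induces_partial_sums:
  assumes "induces z T"
  obtains u v where "\<And>n. u n \<in> V" "(\<lambda>n. \<iota> (u n)) \<longlonglongrightarrow> z"
    "\<And>n x. evaluates x (u n) (v n x)" "\<And>x. (\<lambda>n. v n x) \<longlonglongrightarrow> T x"
proof -
  from assms obtain f y where f: "tensor_rep z f y" and y: "nuclear_rep sX sY T f y"
    by (auto simp: induces_def)
  show ?thesis
  proof (rule that)
    show "(\<Sum>i<n. elem (f i) (y i)) \<in> V" for n
      using f by (intro T.subspace_sum[OF subspace_V] elem_V) (simp add: tensor_rep_def)
    have "\<iota> (\<Sum>i<n. elem (f i) (y i)) = (\<Sum>i<n. \<iota> (elem (f i) (y i)))" for n
      using f by (intro iota_sum elem_V) (simp add: tensor_rep_def)
    then show "(\<lambda>n. \<iota> (\<Sum>i<n. elem (f i) (y i))) \<longlonglongrightarrow> z"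
      using f by (simp add: tensor_rep_def sums_def)
    show "evaluates x (\<Sum>i<n. elem (f i) (y i)) (\<Sum>i<n. sY (f i x) (y i))" for n x
      by (intro evaluates_sum evaluates_elem)
    show "(\<lambda>n. \<Sum>i<n. sY (f i x) (y i)) \<longlonglongrightarrow> T x" for x
      using y by (simp add: nuclear_rep_def sums_def)
  qed
qed

text \<open>The three representations are unrelated, so their partial sums are compared: the
  algebraic tensors \<open>?r n\<close> tend to 0 in the completion, and
  \<open>evaluates_bound\<close> forces their values \<open>?s n\<close> at \<open>x\<close> to 0.
  Linearity and well-definedness of J both come from this.\<close>

lemma induces_linear:
  assumes "induces z T" "induces z' T'" "induces (z + sZ c z') S"
  shows "S x = T x + sY c (T' x)"
proof -
  obtain u v where u: "\<And>n. u n \<in> V" "(\<lambda>n. \<iota> (u n)) \<longlonglongrightarrow> z"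
    "\<And>n x. evaluates x (u n) (v n x)" "\<And>x. (\<lambda>n. v n x) \<longlonglongrightarrow> T x"
    by (rule induces_partial_sums[OF assms(1)]) (rule that)
  obtain u' v' where u': "\<And>n. u' n \<in> V" "(\<lambda>n. \<iota> (u' n)) \<longlonglongrightarrow> z'"
    "\<And>n x. evaluates x (u' n) (v' n x)" "\<And>x. (\<lambda>n. v' n x) \<longlonglongrightarrow> T' x"
    by (rule induces_partial_sums[OF assms(2)]) (rule that)
  obtain p q where p: "\<And>n. p n \<in> V" "(\<lambda>n. \<iota> (p n)) \<longlonglongrightarrow> z + sZ c z'"
    "\<And>n x. evaluates x (p n) (q n x)" "\<And>x. (\<lambda>n. q n x) \<longlonglongrightarrow> S x"
    by (rule induces_partial_sums[OF assms(3)]) (rule that)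
  let ?r = "\<lambda>n. p n - u n - tensor_scale c (u' n)"
  let ?s = "\<lambda>n. q n x - v n x - sY c (v' n x)"
  have r: "?r n \<in> V" for n
    by (intro T.subspace_diff[OF subspace_V] T.subspace_scale[OF subspace_V] p u u')
  have "\<iota> (?r n) = \<iota> (p n) - \<iota> (u n) - sZ c (\<iota> (u' n))" for n
    by (simp add: iota_diff iota_scale p u u' T.subspace_diff[OF subspace_V]
        T.subspace_scale[OF subspace_V])
  then have "(\<lambda>n. \<iota> (?r n)) \<longlonglongrightarrow> (z + sZ c z') - z - sZ c z'"
    by (simp only:) (intro tendsto_diff p u bounded_linear.tendsto[OF Z.bounded_linear_scale_right] u')
  then have "(\<lambda>n. norm x * norm (\<iota> (?r n))) \<longlonglongrightarrow> 0"
    by (intro tendsto_mult_right_zero tendsto_norm_zero) simp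
  moreover have "norm (?s n) \<le> norm x * norm (\<iota> (?r n))" for n
    by (intro evaluates_bound r evaluates_diff evaluates_scale p u u')
  ultimately have "?s \<longlonglongrightarrow> 0"
    by (intro Lim_null_comparison[of ?s, OF always_eventually]) auto
  moreover have "?s \<longlonglongrightarrow> S x - T x - sY c (T' x)"
    by (intro tendsto_diff p u bounded_linear.tendsto[OF Y.bounded_linear_scale_right] u')
  ultimately have "S x - T x - sY c (T' x) = 0"
    using LIMSEQ_unique by blast
  then show ?thesis by (simp add: algebra_simps)
qed

lemma induces_zero: "induces 0 0"
  unfolding induces_def
  by (intro exI[of _ "\<lambda>_. 0"])
    (simp add: tensor_rep_def nuclear_rep_def zero_dual elem_zero iota_zero)

text \<open>The case \<open>z' = 0\<close>, \<open>c = 0\<close> of \<open>induces_linear\<close>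
  compares two representations of one tensor.\<close>

lemma induces_unique: "induces z T \<Longrightarrow> induces z S \<Longrightarrow> S = T"
  using induces_linear[OF _ induces_zero, of z T 0 S] by (auto intro: blinfun_eqI)

section \<open>The canonical map and its kernel\<close>

lemma canonical_J_eq_iff: "canonical_J sX sY \<iota> z = T \<longleftrightarrow> induces z T"
proof -
  \<comment> \<open>Membership in \<open>nuclear_operators\<close> is automatic by
    \<open>nuclear_rep_operator\<close>, so the predicate under the description is exactly
    \<open>induces z\<close>.\<close>
  have iff: "(S \<in> nuclear_operators sX sY \<and>
      (\<exists>f y. nuclear_rep sX sY S f y \<and> (\<lambda>i. \<iota> (elem (f i) (y i))) sums z)) \<longleftrightarrow> induces z S" for S
    using nuclear_rep_operator[of S] by (auto simp: induces_def tensor_rep_def nuclear_rep_def)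
  have "canonical_J sX sY \<iota> z = (THE S. induces z S)"
    by (simp only: canonical_J_def iff)
  moreover have "\<exists>!S. induces z S"
    using induces_total induces_unique by blast
  ultimately show ?thesis
    by (metis theI')
qed

lemma canonical_J_add_scale:
  "canonical_J sX sY \<iota> (z + sZ c z') x = canonical_J sX sY \<iota> z x + sY c (canonical_J sX sY \<iota> z' x)"
  by (rule induces_linear) (simp_all add: canonical_J_eq_iff[symmetric])

lemma canonical_J_diff:
  "canonical_J sX sY \<iota> (z - z') = canonical_J sX sY \<iota> z - canonical_J sX sY \<iota> z'"
  using canonical_J_add_scale[of z "-1" z'] by (intro blinfun_eqI) (simp add: blinfun.diff_left)

lemma canonical_J_zero: "canonical_J sX sY \<iota> 0 = 0"
  by (simp add: canonical_J_eq_iff induces_zero)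

lemma subspace_kernel: "Z.subspace {z. canonical_J sX sY \<iota> z = 0}"
proof (rule Z.subspaceI)
  fix z z' c
  assume "z \<in> {z. canonical_J sX sY \<iota> z = 0}"
  then have z: "canonical_J sX sY \<iota> z = 0" by simp
  show "sZ c z \<in> {z. canonical_J sX sY \<iota> z = 0}"
    using canonical_J_add_scale[of 0 c z] by (auto intro!: blinfun_eqI simp: z canonical_J_zero)
  assume "z' \<in> {z. canonical_J sX sY \<iota> z = 0}"
  then show "z + z' \<in> {z. canonical_J sX sY \<iota> z = 0}"
    using canonical_J_add_scale[of z 1 z'] by (auto intro!: blinfun_eqI simp: z)
qed (simp add: canonical_J_zero)

section \<open>Norm comparison and proximinality\<close>

lemma nuclear_norm_canonical_J_le: "nuclear_norm sX sY (canonical_J sX sY \<iota> z) \<le> norm z"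
proof (rule field_le_epsilon)
  fix e :: real assume "e > 0"
  then obtain f y where f: "tensor_rep z f y"
    and le: "(\<Sum>i. norm (f i) * norm (y i)) \<le> norm z + e"
    using tensor_rep_exists by blast
  obtain T where "nuclear_rep sX sY T f y" "canonical_J sX sY \<iota> z = T"
    using tensor_rep_induces[OF f] by (auto simp: canonical_J_eq_iff)
  then have "nuclear_norm sX sY (canonical_J sX sY \<iota> z) \<le> (\<Sum>i. norm (f i) * norm (y i))"
    unfolding nuclear_norm_def
    by (intro cInf_lower bdd_belowI[of _ 0])
      (auto simp: nuclear_rep_def intro!: suminf_nonneg)
  then show "nuclear_norm sX sY (canonical_J sX sY \<iota> z) \<le> norm z + e"
    using le by linarith
qed

lemma canonical_J_nuclear: "canonical_J sX sY \<iota> z \<in> nuclear_operators sX sY"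
  using canonical_J_eq_iff[of z] nuclear_rep_operator by (auto simp: induces_def)

lemma proximinal_kernel:
  assumes NA: "NA_nu sX sY = nuclear_operators sX sY"
  shows "proximinal_subspace sZ {z. canonical_J sX sY \<iota> z = 0}"
  unfolding proximinal_subspace_def
proof (intro conjI allI)
  let ?W = "{z. canonical_J sX sY \<iota> z = 0}"
  show "Z.subspace ?W" by (rule subspace_kernel)
  fix z
  let ?T = "canonical_J sX sY \<iota> z"
  have "?T \<in> NA_nu sX sY"
    using NA canonical_J_nuclear by simp
  then obtain f y where f: "nuclear_rep sX sY ?T f y"
    "(\<Sum>i. norm (f i) * norm (y i)) = nuclear_norm sX sY ?T"
    by (auto simp: NA_nu_def)
  obtain z' where z': "canonical_J sX sY \<iota> z' = ?T" "norm z' \<le> nuclear_norm sX sY ?T"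
    using nuclear_rep_induces[OF f(1)] unfolding f(2) by (auto simp: canonical_J_eq_iff)
  have w: "z - z' \<in> ?W"
    by (simp add: canonical_J_diff z')
  have "norm z' \<le> norm (z - v)" if "v \<in> ?W" for v
    using z'(2) nuclear_norm_canonical_J_le[of "z - v"] that by (simp add: canonical_J_diff)
  \<comment> \<open>Since \<open>z - (z - z') = z'\<close>, the lower bound \<open>norm z'\<close>
    is itself one of the distances, so the infimum is a minimum.\<close>
  then have "norm (z - (z - z')) = (INF v \<in> ?W. norm (z - v))"
    using w by (intro cInf_eq_minimum[symmetric]) (auto intro!: image_eqI[of _ _ "z - z'"])
  then show "\<exists>w\<in>?W. norm (z - w) = (INF v \<in> ?W. norm (z - v))"
    using w by blast
qed

end

theorem proposition4p1:
  fixes sX :: "'k::rc_field \<Rightarrow> 'x::banach \<Rightarrow> 'x"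
    and sY :: "'k \<Rightarrow> 'y::banach \<Rightarrow> 'y"
    and sZ :: "'k \<Rightarrow> 'z::banach \<Rightarrow> 'z"
    and \<iota> :: "('k, 'x, 'y) tensor \<Rightarrow> 'z"
  assumes "banach_over sX"
    and "banach_over sY"
    and "is_projective_tensor_product sX sY sZ \<iota>"
    and "NA_nu sX sY = nuclear_operators sX sY"
  shows "proximinal_subspace sZ {z. canonical_J sX sY \<iota> z = 0}"
proof -
  interpret projective_tensor_product sX sY sZ \<iota>
    using assms(1-3)
    by (simp add: projective_tensor_product_def projective_tensor_product_axioms_def)
  show ?thesis
    by (rule proximinal_kernel[OF assms(4)])
qed

end
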